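(* For all $n\ge0$, $\mathfrak{C}_3\subseteq\mathfrak{C}_{2,n}$. Similarly, $\mathfrak{C}_3^+\subseteq\mathfrak{C}_{2,n}^+$ and $\mathfrak{C}_3^-\subseteq\mathfrak{C}_{2,n}^-$ for all $n\ge 0$.
   Context: Everything is smooth; $S^3=\partial B^4$. For a group $G$, $G^{(n)}$ is the $n$-th term of the derived series. A kinky disk in an oriented 4-manifold $M$ is the image of a self-transverse immersion $f:D^2\to M$ with $f^{-1}(\partial M)=\partial D^2$; its double points are called kinks, and each has a canonical sign. A kinky handle $\kappa$ is a regular neighborhood of a kinky disk (its core); its attaching curve is $f(\partial D^2)$. The attaching curve has a canonical framing: the unique framing such that attaching a 2-handle to $\kappa$ along it gives a 4-manifold with zero intersection form (equivalently, the attaching curve and its pushoff bound disjoint embedded surfaces in $\kappa$). If there are $k$ kinks, $\kappa\cong\natural_k S^1\times D^3$ has a Kirby diagram consisting of $k$ unlinked unknotted dotted circles; the attaching curve is an unknot passing through each dotted circle to clasp itself there (forming a Whitehead link with each dotted circle), the sign of each clasp being the sign of the corresponding kink, and the canonical framing being the 0-framing in this diagram. The standard set of curves for $\kappa$ consists of the 0-framed meridians of the dotted circles; attaching 2-handles along these turns ($\kappa$, attaching curve) into the standard 2-handle $(D^2\times D^2,\partial D^2\times\{0\})$. A Casson tower of height one is a kinky handle. A Casson tower of height $n+1$ is obtained from one of height $n$ by attaching a kinky handle (an $(n+1)$-th stage kinky handle), along its attaching curve and matching framings, to each member of a standard set of curves of the height $n$ tower; a standard set of curves of a tower of height $n$ is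 the union of the standard sets for its $n$-th stage kinky handles. The attaching curve of a tower is that of its first-stage kinky handle; base-level kinks are the kinks of the first-stage kinky disk. The core of a tower is the 2-complex (a strong deformation retract) consisting of the cores of all kinky handles together with canonical annuli joining successive stages. A knot $K$ bounds a Casson tower $T$ if there is a proper embedding of $T$ in $B^4$ identifying a 0-framed neighborhood of the attaching curve of $T$ with a 0-framed neighborhood of $K$ in $S^3$. $\mathfrak{C}_3$ is the set of knots bounding a Casson tower of height three. $\mathfrak{C}_{2,n}$ is the set of knots bounding a Casson tower $T$ of height two such that each member of a standard set of curves for $T$ is in $\pi_1(B^4-C)^{(n)}$, where $C$ is the core of $T$. $\mathfrak{C}_3^{+}$, $\mathfrak{C}_{2,n}^{+}$ (resp. $\mathfrak{C}_3^-$, $\mathfrak{C}_{2,n}^-$) are defined in the same way, with the additional requirement that all base-level kinks of the tower be positive (resp. negative). *)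

theory Defs
  imports "HOL-Analysis.Analysis" "HOL-Algebra.Generated_Groups"
begin

text \<open>
  The ambient oriented 4-manifold is $\mathbb C^2 = \mathbb R^4$ with its standard
  orientation; $B^4$ is \<^term>\<open>cball 0 1\<close> and $S^3$ is \<^term>\<open>sphere 0 1\<close>.  Only Casson towers
  that are embedded in $B^4$ are needed, so kinky handles and towers are codimension-zero
  subsets of $\mathbb R^4$.
\<close>

type_synonym r4 = "complex \<times> complex"

abbreviation disk :: "complex set" where "disk \<equiv> cball 0 1"
abbreviation B4 :: "r4 set" where "B4 \<equiv> cball 0 1"
abbreviation S3 :: "r4 set" where "S3 \<equiv> sphere 0 1"

subsection \<open>Smooth maps and orientations\<close>

text \<open>
  On an open subset \<open>U\<close> of a finite-dimensional space, \<open>smooth_on U f\<close> says that \<open>f\<close> is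
  $C^\infty$: all iterated directional derivatives exist and are differentiable.
\<close>

abbreviation fderiv :: "('a::real_normed_vector \<Rightarrow> 'b::real_normed_vector) \<Rightarrow> 'a \<Rightarrow> 'a \<Rightarrow> 'b"
  where "fderiv f x \<equiv> frechet_derivative f (at x)"

coinductive smooth_on ::
  "'a::real_normed_vector set \<Rightarrow> ('a \<Rightarrow> 'b::real_normed_vector) \<Rightarrow> bool" for U where
  "\<lbrakk>\<forall>x\<in>U. f differentiable (at x); \<forall>v. smooth_on U (\<lambda>x. fderiv f x v)\<rbrakk> \<Longrightarrow> smooth_on U f"

definition smooth_near ::
  "'a::real_normed_vector set \<Rightarrow> ('a \<Rightarrow> 'b::real_normed_vector) \<Rightarrow> bool" where
  "smooth_near A f \<longleftrightarrow> (\<exists>U. open U \<and> A \<subseteq> U \<and> smooth_on U f)"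

definition coords :: "r4 \<Rightarrow> real ^ 4" where
  "coords p = vector [Re (fst p), Im (fst p), Re (snd p), Im (snd p)]"

definition det4 :: "r4 \<Rightarrow> r4 \<Rightarrow> r4 \<Rightarrow> r4 \<Rightarrow> real" where
  "det4 p q r s = det (vector [coords p, coords q, coords r, coords s] :: real ^ 4 ^ 4)"

definition knot :: "r4 set \<Rightarrow> bool" where
  "knot K \<longleftrightarrow> (\<exists>c :: real \<Rightarrow> r4. smooth_on UNIV c \<and> (\<forall>t. c (t + 1) = c t) \<and>
      inj_on c {0..<1} \<and> (\<forall>t. fderiv c t 1 \<noteq> 0) \<and> c ` {0..1} = K \<and> K \<subseteq> S3)"

subsection \<open>Embedded oriented surfaces\<close>

text \<open>
  A chart of $\mathbb R^4$ flattening the surface \<open>S\<close> onto an open piece of the closed half plane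
  $\{\mathrm{Im} \ge 0\} \times 0$, and its boundary \<open>J\<close> onto $\{\mathrm{Im} = 0\} \times 0$.
\<close>

definition surface_chart :: "r4 set \<Rightarrow> r4 set \<Rightarrow> r4 set \<times> (r4 \<Rightarrow> r4) \<Rightarrow> bool" where
  "surface_chart S J = (\<lambda>(U, \<phi>). open U \<and> smooth_on U \<phi> \<and> inj_on \<phi> U \<and>
      (\<forall>x\<in>U. inj (fderiv \<phi> x)) \<and>
      S \<inter> U = {x \<in> U. snd (\<phi> x) = 0 \<and> Im (fst (\<phi> x)) \<ge> 0} \<and>
      J \<inter> U = {x \<in> U. snd (\<phi> x) = 0 \<and> Im (fst (\<phi> x)) = 0})"

text \<open>
  The charts \<open>\<phi>\<close>, \<open>\<psi>\<close> induce the same orientation of the surface at \<open>x\<close>: \<open>u\<close>, \<open>v\<close> is the basis of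
  the tangent plane that \<open>\<phi>\<close> sends to the standard basis \<open>1\<close>, \<open>\<i>\<close>, and \<open>Im (cnj a * b)\<close> is the
  determinant of \<open>(a, b)\<close>.
\<close>

definition same_orientation :: "r4 \<Rightarrow> (r4 \<Rightarrow> r4) \<Rightarrow> (r4 \<Rightarrow> r4) \<Rightarrow> bool" where
  "same_orientation x \<phi> \<psi> \<longleftrightarrow> (\<forall>u v. fderiv \<phi> x u = (1, 0) \<and> fderiv \<phi> x v = (\<i>, 0) \<longrightarrow>
      Im (cnj (fst (fderiv \<psi> x u)) * fst (fderiv \<psi> x v)) > 0)"

text \<open>\<open>S\<close> is a compact oriented smoothly embedded surface in $\mathbb R^4$ with boundary \<open>J\<close>.\<close>

definition oriented_surface :: "r4 set \<Rightarrow> r4 set \<Rightarrow> bool" where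
  "oriented_surface S J \<longleftrightarrow> compact S \<and> J \<subseteq> S \<and>
      (\<exists>\<A>. (\<forall>c\<in>\<A>. surface_chart S J c) \<and> S \<subseteq> (\<Union>c\<in>\<A>. fst c) \<and>
        (\<forall>(U, \<phi>)\<in>\<A>. \<forall>(V, \<psi>)\<in>\<A>. \<forall>x\<in>S \<inter> U \<inter> V. same_orientation x \<phi> \<psi>))"

subsection \<open>Kinky disks\<close>

text \<open>
  \<open>crossing f z z'\<close> is nonzero iff the two sheets of \<open>f\<close> at \<open>z\<close> and \<open>z'\<close> are transverse, and then
  its sign is the sign of the kink \<open>f z = f z'\<close>.
\<close>

definition crossing :: "(complex \<Rightarrow> r4) \<Rightarrow> complex \<Rightarrow> complex \<Rightarrow> real" where
  "crossing f z z' = det4 (fderiv f z 1) (fderiv f z \<i>) (fderiv f z' 1) (fderiv f z' \<i>)"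

definition self_transverse_immersion :: "(complex \<Rightarrow> r4) \<Rightarrow> bool" where
  "self_transverse_immersion f \<longleftrightarrow> smooth_near disk f \<and> (\<forall>z\<in>disk. inj (fderiv f z)) \<and>
      (\<forall>z\<in>disk. \<forall>z'\<in>disk. z \<noteq> z' \<and> f z = f z' \<longrightarrow> crossing f z z' \<noteq> 0) \<and>
      (\<forall>x\<in>disk. \<forall>y\<in>disk. \<forall>z\<in>disk. f x = f y \<and> f y = f z \<longrightarrow> x = y \<or> y = z \<or> x = z)"

definition kinky_disk :: "(complex \<Rightarrow> r4) \<Rightarrow> r4 set \<Rightarrow> bool" where
  "kinky_disk f M \<longleftrightarrow> self_transverse_immersion f \<and> f ` disk \<subseteq> M \<and>
      {z \<in> disk. f z \<in> frontier M} = sphere 0 1"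

subsection \<open>Kinky handles\<close>

text \<open>
  A regular neighbourhood of a kinky disk with \<open>k\<close> kinks is a self-plumbing of $D^2 \times D^2$
  with rounded corners.  It is presented by a local diffeomorphism \<open>par\<close> of $D^2 \times D^2$ into
  $\mathbb R^4$ which extends the kinky disk \<open>\<lambda>z. par (z, 0)\<close>.  After a diffeomorphism of $D^2$ the two
  preimages of the \<open>i\<close>-th kink (\<open>i < k\<close>) are the centres of the small disks \<open>chart_a k i\<close> and
  \<open>chart_b k i\<close>; the \<open>2 * k\<close> centres are equally spaced on the real axis, in the order
  \<open>a_0 < b_0 < a_1 < b_1 < \<dots>\<close>, and the disks are pairwise disjoint.

  Corners are rounded by the level sets of \<open>wt z * |y|\<^sup>2\<close>.  In the plumbing charts
  \<open>wt\<close> is \<open>|x|\<^sup>2\<close>, so there this function is \<open>|x|\<^sup>2 * |y|\<^sup>2\<close>, which is compatible with the plumbing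
  identifications; consequently the outer boundary is smooth.
\<close>

record khandle =
  par :: "complex \<times> complex \<Rightarrow> r4"
  kinks :: nat
  wt :: "complex \<Rightarrow> real"

definition chart_a :: "nat \<Rightarrow> nat \<Rightarrow> complex \<Rightarrow> complex" where
  "chart_a k i x = of_real (-1 + (4 * real i + 1) / (2 * real k)) + x / of_real (4 * real k)"

definition chart_b :: "nat \<Rightarrow> nat \<Rightarrow> complex \<Rightarrow> complex" where
  "chart_b k i x = of_real (-1 + (4 * real i + 3) / (2 * real k)) - x / of_real (4 * real k)"

definition core_map :: "khandle \<Rightarrow> complex \<Rightarrow> r4" where
  "core_map H z = par H (z, 0)"

definition core_disk :: "khandle \<Rightarrow> r4 set" where
  "core_disk H = core_map H ` disk"

definition kink_sign :: "khandle \<Rightarrow> nat \<Rightarrow> real" where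
  "kink_sign H i = sgn (crossing (core_map H) (chart_a (kinks H) i 0) (chart_b (kinks H) i 0))"

text \<open>
  The plumbing identification at the \<open>i\<close>-th kink exchanges the base and fibre coordinates, composed
  with complex conjugation in both factors if the kink is negative.
\<close>

definition plumbed :: "khandle \<Rightarrow> nat \<Rightarrow> complex \<times> complex \<Rightarrow> complex \<times> complex \<Rightarrow> bool" where
  "plumbed H i p q \<longleftrightarrow> (\<exists>x\<in>disk. \<exists>y\<in>disk. p = (chart_a (kinks H) i x, y) \<and>
      q = (if kink_sign H i > 0 then (chart_b (kinks H) i y, x)
           else (chart_b (kinks H) i (cnj y), cnj x)))"

definition handle_set :: "khandle \<Rightarrow> r4 set" where
  "handle_set H = par H ` {(z, y). z \<in> disk \<and> y \<in> disk \<and> wt H z * (cmod y)\<^sup>2 \<le> 1/4}"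

definition outer_boundary :: "khandle \<Rightarrow> r4 set" where
  "outer_boundary H = par H ` {(z, y). cmod z < 1 \<and> y \<in> disk \<and> wt H z * (cmod y)\<^sup>2 = 1/4}"

definition attaching_region :: "khandle \<Rightarrow> r4 set" where
  "attaching_region H = par H ` {(z, y). cmod z = 1 \<and> cmod y \<le> 1/2}"

definition attaching_curve :: "khandle \<Rightarrow> r4 set" where
  "attaching_curve H = core_map H ` sphere 0 1"

definition kinky_handle :: "khandle \<Rightarrow> bool" where
  "kinky_handle H \<longleftrightarrow>
    kinky_disk (core_map H) (handle_set H) \<and>
    smooth_near (disk \<times> disk) (par H) \<and>
    (\<forall>p\<in>disk \<times> disk. det4 (fderiv (par H) p (1, 0)) (fderiv (par H) p (\<i>, 0))
                        (fderiv (par H) p (0, 1)) (fderiv (par H) p (0, \<i>)) > 0) \<and>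
    (\<forall>p\<in>disk \<times> disk. \<forall>q\<in>disk \<times> disk.
        par H p = par H q \<longleftrightarrow> p = q \<or> (\<exists>i<kinks H. plumbed H i p q \<or> plumbed H i q p)) \<and>
    smooth_near disk (wt H) \<and>
    (\<forall>i<kinks H. \<forall>x\<in>disk. wt H (chart_a (kinks H) i x) = (cmod x)\<^sup>2 \<and>
                           wt H (chart_b (kinks H) i x) = (cmod x)\<^sup>2) \<and>
    (\<forall>z\<in>disk - (\<Union>i<kinks H. chart_a (kinks H) i ` disk \<union> chart_b (kinks H) i ` disk).
        wt H z > 1/4) \<and>
    (\<forall>z. cmod z = 1 \<longrightarrow> wt H z = 1)"

subsection \<open>The canonical framing of the attaching curve\<close>

text \<open>
  The framings of the attaching curve are indexed by integers \<open>n\<close>; the \<open>n\<close>-th one has normal vector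
  \<open>cis (n \<theta>)\<close> in the fibre over \<open>cis \<theta>\<close>.  The parameter \<open>t\<close> below is \<open>\<theta> / (2 * pi)\<close>.
\<close>

definition framing_pushoff :: "khandle \<Rightarrow> int \<Rightarrow> r4 set" where
  "framing_pushoff H n = (\<lambda>t::real. par H (cis (2 * pi * t), cis (2 * pi * n * t) / 4)) ` {0..1}"

definition framing_field :: "khandle \<Rightarrow> int \<Rightarrow> real \<Rightarrow> r4" where
  "framing_field H n t = fderiv (par H) (cis (2 * pi * t), 0) (0, cis (2 * pi * n * t))"

definition canonical_framing :: "khandle \<Rightarrow> int \<Rightarrow> bool" where
  "canonical_framing H n \<longleftrightarrow> (\<exists>S S'. oriented_surface S (attaching_curve H) \<and>
      oriented_surface S' (framing_pushoff H n) \<and>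
      S \<subseteq> handle_set H \<and> S' \<subseteq> handle_set H \<and> S \<inter> S' = {})"

subsection \<open>The standard set of curves\<close>

text \<open>
  Let \<open>\<gamma>\<close> be the real segment joining the two preimages of the \<open>i\<close>-th kink.  The pushoff to the outer
  boundary, in the direction of the positive real fibre axis, of the double point loop
  \<open>core_map H ` \<gamma>\<close> is a simple closed curve: in the plumbing chart it is the hyperbola
  \<open>x * y = 1/2\<close> with \<open>x, y > 0\<close>, and its ends \<open>u = 0\<close>, \<open>u = 1\<close> are the point \<open>x = y = sqrt (1/2)\<close>
  seen in the two charts.  It runs once over the \<open>i\<close>-th 1-handle, and is the meridian of the \<open>i\<close>-th
  dotted circle in the Kirby diagram of the handle.
\<close>

definition std_point :: "khandle \<Rightarrow> nat \<Rightarrow> real \<Rightarrow> complex \<times> complex" where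
  "std_point H i u =
    (let s = of_real (sqrt (1/2));
         z = of_real (1 - u) * chart_a (kinks H) i s + of_real u * chart_b (kinks H) i s
     in (z, of_real (1 / (2 * sqrt (wt H z)))))"

definition std_curve :: "khandle \<Rightarrow> nat \<Rightarrow> real \<Rightarrow> r4" where
  "std_curve H i u = par H (std_point H i u)"

text \<open>
  Along the standard curve the plane of real base and fibre directions is spanned by the tangent of
  the curve and a vector transverse to the outer boundary.  Hence a framing of the curve in the
  outer boundary is recorded by the imaginary parts \<open>(Im X, Im Y)\<close> of its base and fibre
  components, i.e. by the nonzero complex number \<open>\<zeta> = 4 k Im X + \<i> \<sigma> Im Y\<close>, where \<open>4 k\<close> rescales
  to chart coordinates and \<open>\<sigma>\<close> is the sign of the kink.  The plumbing identification forces
  \<open>\<zeta> 1 = \<i> * \<zeta> 0\<close>, so the total rotation of \<open>\<zeta>\<close> is \<open>pi/2 + 2 pi m\<close>, and the integer \<open>m\<close> classifies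
  the framing.

  The 0-framing of the meridian of the dotted circle is \<open>m = 0\<close>.  To see this, attach a 2-handle
  along the standard curve with framing \<open>m\<close>.  It cancels the 1-handle, and the attaching curve of
  the kinky handle becomes the \<open>m\<close>-twisted Whitehead double of the unknot (up to the sign of \<open>m\<close>),
  which is unknotted exactly for \<open>m = 0\<close>.  Equivalently, in Whitney's model
  \<open>(x - 2x/v, y, 1/v, xy/v)\<close>, \<open>v = (1 + x\<^sup>2) (1 + y\<^sup>2)\<close>, of a disk with one kink, the double point loop
  bounds a flat disk in the plane of the first and third coordinates, and the constant normal
  framing of that disk has \<open>m = 0\<close>.

  \<open>std_framing H i g V\<close> says that the vector field \<open>V\<close> along \<open>\<lambda>t. std_curve H i (g t)\<close> represents
  the 0-framing.
\<close>

definition std_framing :: "khandle \<Rightarrow> nat \<Rightarrow> (real \<Rightarrow> real) \<Rightarrow> (real \<Rightarrow> r4) \<Rightarrow> bool" where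
  "std_framing H i g V \<longleftrightarrow>
    (\<exists>X Y :: real \<Rightarrow> complex. \<exists>\<theta> \<rho> :: real \<Rightarrow> real.
      continuous_on {0..1} \<theta> \<and> \<theta> 1 = \<theta> 0 + pi / 2 \<and>
      (\<forall>t\<in>{0..1}. V t = fderiv (par H) (std_point H i (g t)) (X t, Y t) \<and> \<rho> t > 0 \<and>
        Complex (4 * real (kinks H) * Im (X t)) (kink_sign H i * Im (Y t)) = of_real (\<rho> t) * cis (\<theta> t)))"

text \<open>
  The kinky handle \<open>H'\<close> is attached along its attaching curve to the \<open>i\<close>-th standard curve of \<open>H\<close>,
  with the canonical framing matching the 0-framing.  (\<open>g\<close> is a reparametrization.)
\<close>

definition attached :: "khandle \<Rightarrow> khandle \<Rightarrow> nat \<Rightarrow> bool" where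
  "attached H' H i \<longleftrightarrow> attaching_region H' \<subseteq> outer_boundary H \<and>
    (\<exists>g n. continuous_on {0..1} g \<and> strict_mono_on {0..1} g \<and> g 0 = 0 \<and> g 1 = 1 \<and>
      (\<forall>t\<in>{0..1}. core_map H' (cis (2 * pi * t)) = std_curve H i (g t)) \<and>
      canonical_framing H' n \<and> std_framing H i g (framing_field H' n))"

subsection \<open>Casson towers\<close>

text \<open>
  A tower is the list of its stages, lowest first; each stage is the list of its kinky handles.  The
  standard set of curves is represented by the pairs \<open>(H, i)\<close> standing for the framed curves
  \<open>std_curve H i\<close>.
\<close>

type_synonym tower = "khandle list list"

definition standard_set :: "tower \<Rightarrow> (khandle \<times> nat) list" where
  "standard_set T = concat (map (\<lambda>H. map (\<lambda>i. (H, i)) [0..<kinks H]) (last T))"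

definition tower_set :: "tower \<Rightarrow> r4 set" where
  "tower_set T = (\<Union>H\<in>set (concat T). handle_set H)"

inductive casson_tower :: "nat \<Rightarrow> tower \<Rightarrow> bool" where
  one: "kinky_handle H \<Longrightarrow> casson_tower 1 [[H]]"
| step: "\<lbrakk>casson_tower n T;
          list_all2 (\<lambda>H' (H, i). kinky_handle H' \<and> attached H' H i) L (standard_set T);
          \<forall>H'\<in>set L. handle_set H' \<inter> tower_set T = attaching_region H';
          \<forall>i<length L. \<forall>j<length L. i \<noteq> j \<longrightarrow> handle_set (L ! i) \<inter> handle_set (L ! j) = {}\<rbrakk>
         \<Longrightarrow> casson_tower (Suc n) (T @ [L])"

abbreviation first_handle :: "tower \<Rightarrow> khandle" where
  "first_handle T \<equiv> hd (hd T)"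

text \<open>
  The canonical annulus between a standard curve and the double point loop in the core disk: it is
  swept out by the radii of the fibres over the segment \<open>\<gamma>\<close>.
\<close>

definition annulus :: "khandle \<Rightarrow> nat \<Rightarrow> r4 set" where
  "annulus H i = par H ` {(z, of_real s) | z s :: real.
      z \<in> closed_segment (chart_a (kinks H) i 0) (chart_b (kinks H) i 0) \<and>
      0 \<le> s \<and> s \<le> 1 \<and> wt H z * s\<^sup>2 \<le> 1/4}"

definition tower_core :: "tower \<Rightarrow> r4 set" where
  "tower_core T = (\<Union>H\<in>set (concat T). core_disk H) \<union>
                  (\<Union>H\<in>set (concat (butlast T)). \<Union>i<kinks H. annulus H i)"

text \<open>
  The last conjunct says that the framing of the knot \<open>K\<close> induced by the canonical framing of the
  attaching curve is the 0-framing, i.e. the one given by a Seifert surface.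
\<close>

definition bounds_tower :: "r4 set \<Rightarrow> tower \<Rightarrow> bool" where
  "bounds_tower K T \<longleftrightarrow> tower_set T \<subseteq> B4 \<and>
    tower_set T \<inter> S3 = attaching_region (first_handle T) \<and>
    attaching_curve (first_handle T) = K \<and>
    (\<exists>n S. canonical_framing (first_handle T) n \<and> oriented_surface S K \<and> S \<subseteq> S3 \<and>
       S \<inter> framing_pushoff (first_handle T) n = {})"

subsection \<open>Fundamental group\<close>

definition path_class :: "'a::topological_space set \<Rightarrow> (real \<Rightarrow> 'a) \<Rightarrow> (real \<Rightarrow> 'a) set" where
  "path_class X p = {q. homotopic_paths X p q}"

definition fundamental_group :: "'a::real_normed_vector set \<Rightarrow> 'a \<Rightarrow> (real \<Rightarrow> 'a) set monoid" where
  "fundamental_group X x0 =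
    \<lparr>carrier = {path_class X p | p. path p \<and> path_image p \<subseteq> X \<and> pathstart p = x0 \<and> pathfinish p = x0},
     mult = (\<lambda>A B. {r. \<exists>p\<in>A. \<exists>q\<in>B. homotopic_paths X (p +++ q) r}),
     one = path_class X (linepath x0 x0)\<rparr>"

text \<open>
  The loop \<open>c\<close> lies in \<open>X\<close> and represents an element of the \<open>n\<close>-th derived subgroup of the
  fundamental group of \<open>X\<close>.  The base point is taken on \<open>c\<close>; for path-connected \<open>X\<close>
  the choice of base point and connecting path is immaterial, since
  derived subgroups are preserved by isomorphisms.
\<close>

definition in_derived_pi1 :: "nat \<Rightarrow> 'a::real_normed_vector set \<Rightarrow> (real \<Rightarrow> 'a) \<Rightarrow> bool" where
  "in_derived_pi1 n X c \<longleftrightarrow> path c \<and> path_image c \<subseteq> X \<and> pathfinish c = pathstart c \<and>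
    (let G = fundamental_group X (pathstart c)
     in path_class X c \<in> (derived G ^^ n) (carrier G))"

subsection \<open>The filtrations\<close>

definition base_positive :: "tower \<Rightarrow> bool" where
  "base_positive T \<longleftrightarrow> (\<forall>i<kinks (first_handle T). kink_sign (first_handle T) i = 1)"

definition base_negative :: "tower \<Rightarrow> bool" where
  "base_negative T \<longleftrightarrow> (\<forall>i<kinks (first_handle T). kink_sign (first_handle T) i = -1)"

definition curves_in_derived :: "nat \<Rightarrow> tower \<Rightarrow> bool" where
  "curves_in_derived n T \<longleftrightarrow>
    (\<forall>(H, i)\<in>set (standard_set T). in_derived_pi1 n (B4 - tower_core T) (std_curve H i))"

definition C3 :: "r4 set set" where
  "C3 = {K. knot K \<and> (\<exists>T. casson_tower 3 T \<and> bounds_tower K T)}"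

definition C3_pos :: "r4 set set" where
  "C3_pos = {K. knot K \<and> (\<exists>T. casson_tower 3 T \<and> bounds_tower K T \<and> base_positive T)}"

definition C3_neg :: "r4 set set" where
  "C3_neg = {K. knot K \<and> (\<exists>T. casson_tower 3 T \<and> bounds_tower K T \<and> base_negative T)}"

definition C2 :: "nat \<Rightarrow> r4 set set" where
  "C2 n = {K. knot K \<and> (\<exists>T. casson_tower 2 T \<and> bounds_tower K T \<and> curves_in_derived n T)}"

definition C2_pos :: "nat \<Rightarrow> r4 set set" where
  "C2_pos n = {K. knot K \<and> (\<exists>T. casson_tower 2 T \<and> bounds_tower K T \<and> curves_in_derived n T \<and>
                 base_positive T)}"

definition C2_neg :: "nat \<Rightarrow> r4 set set" where
  "C2_neg n = {K. knot K \<and> (\<exists>T. casson_tower 2 T \<and> bounds_tower K T \<and> curves_in_derived n T \<and>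
                 base_negative T)}"

end

theory Submission
  imports Defs
begin

text \<open>
  Forgetting the third stage of a tower of height three leaves a tower of height two that is
  bounded by the same knot.  A standard curve of this smaller tower is the boundary of the core
  disk of a third-stage kinky handle.  That disk is only immersed, but an immersed disk is still a
  continuous map of \<open>D\<^sup>2\<close>; so as soon as it misses the core \<open>C\<close> of the smaller tower, the standard
  curve is null-homotopic in \<open>B\<^sup>4 - C\<close> and hence lies in every term of the derived series.

  That the disk misses \<open>C\<close> is the geometric content.  Each third-stage handle meets the smaller
  tower exactly in its attaching region, which lies on the outer boundary of some top-stage handle
  \<open>H\<close>.  The outer boundary of \<open>H\<close> is disjoint from the core disk of \<open>H\<close> (lemma
  \<open>outer_boundary_Int_core_disk\<close>), from the other handles of the same stage, and from all lower
  stages, because \<open>H\<close> touches those only along its own attaching region, which is disjoint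
  from its outer boundary (lemma \<open>outer_boundary_Int_attaching_region\<close>).  This combines to
  \<open>outer_boundary_Int_tower_core\<close>.
\<close>

section \<open>The parts of a kinky handle\<close>

text \<open>
  The outermost chart disks reach only as far as the points \<open>\<plusminus>(1 - 1 / (4 k))\<close> of the real axis, so
  plumbing never involves the fibres over the boundary circle.
\<close>

lemma norm_chart_less_1:
  assumes "i < k" "x \<in> disk"
  shows "cmod (chart_a k i x) < 1" "cmod (chart_b k i x) < 1"
proof -
  have k: "real k > 0" and ik: "real i + 1 \<le> real k"
    using assms(1) by linarith+
  have x: "cmod (x / of_real (4 * real k)) \<le> 1 / (4 * real k)"
    using assms(2) k by (simp add: norm_divide divide_right_mono)
  have "\<bar>-1 + (4 * real i + 1) / (2 * real k)\<bar> \<le> 1 - 1 / (2 * real k)"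
       "\<bar>-1 + (4 * real i + 3) / (2 * real k)\<bar> \<le> 1 - 1 / (2 * real k)"
    using k ik by (auto simp: abs_le_iff field_simps)
  moreover have "1 / (4 * real k) < 1 / (2 * real k)"
    using k by (simp add: field_simps)
  ultimately have lt: "\<bar>-1 + (4 * real i + 1) / (2 * real k)\<bar> + 1 / (4 * real k) < 1"
       "\<bar>-1 + (4 * real i + 3) / (2 * real k)\<bar> + 1 / (4 * real k) < 1"
    by linarith+
  have "cmod (chart_a k i x) \<le>
      cmod (of_real (-1 + (4 * real i + 1) / (2 * real k))) + cmod (x / of_real (4 * real k))"
    unfolding chart_a_def by (rule norm_triangle_ineq)
  with x lt(1) show "cmod (chart_a k i x) < 1"
    unfolding norm_of_real by linarith
  have "cmod (chart_b k i x) \<le>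
      cmod (of_real (-1 + (4 * real i + 3) / (2 * real k))) + cmod (x / of_real (4 * real k))"
    unfolding chart_b_def by (rule norm_triangle_ineq4)
  with x lt(2) show "cmod (chart_b k i x) < 1"
    unfolding norm_of_real by linarith
qed

lemma kinky_handle_par_eqD:
  assumes "kinky_handle H" "p \<in> disk \<times> disk" "q \<in> disk \<times> disk" "par H p = par H q"
  obtains "p = q" | i where "i < kinks H" "plumbed H i p q \<or> plumbed H i q p"
  using assms unfolding kinky_handle_def by blast

lemma plumbed_norm_base_less_1:
  assumes "plumbed H i p q" "i < kinks H"
  shows "cmod (fst p) < 1" "cmod (fst q) < 1"
  using assms norm_chart_less_1[of i "kinks H"]
  by (auto simp: plumbed_def split: if_splits)

text \<open>
  In the plumbing charts \<open>wt H z * |y|\<^sup>2\<close> is \<open>|x|\<^sup>2 * |y|\<^sup>2\<close>, which is symmetric in \<open>x\<close> and \<open>y\<close>; hence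
  it is a well-defined function on the handle.  It vanishes on the core disk and is \<open>1/4\<close> on the
  outer boundary.
\<close>

lemma plumbed_level_eq:
  assumes "kinky_handle H" "plumbed H i p q" "i < kinks H"
  shows "wt H (fst p) * (cmod (snd p))\<^sup>2 = wt H (fst q) * (cmod (snd q))\<^sup>2"
proof -
  have wt: "wt H (chart_a (kinks H) i x) = (cmod x)\<^sup>2" "wt H (chart_b (kinks H) i x) = (cmod x)\<^sup>2"
    if "x \<in> disk" for x
    using assms(1,3) that unfolding kinky_handle_def by blast+
  have "wt H (chart_b (kinks H) i (cnj y)) = (cmod y)\<^sup>2" if "y \<in> disk" for y
    using wt(2)[of "cnj y"] that by simp
  then show ?thesis
    using assms(2) wt by (auto simp: plumbed_def split: if_splits)
qed

lemma outer_boundary_subset_handle_set: "outer_boundary H \<subseteq> handle_set H"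
  unfolding outer_boundary_def handle_set_def by (rule image_mono) auto

lemma attaching_region_subset_handle_set:
  assumes "kinky_handle H"
  shows "attaching_region H \<subseteq> handle_set H"
  unfolding attaching_region_def handle_set_def
proof (rule image_mono, clarify)
  fix z y :: complex assume z: "cmod z = 1" and y: "cmod y \<le> 1/2"
  have "wt H z = 1"
    using assms z unfolding kinky_handle_def by blast
  then show "z \<in> disk \<and> y \<in> disk \<and> wt H z * (cmod y)\<^sup>2 \<le> 1/4"
    using z y power_mono[OF y, of 2] by (simp add: power2_eq_square)
qed

lemma core_disk_subset_handle_set: "core_disk H \<subseteq> handle_set H"
  by (auto simp: core_disk_def core_map_def handle_set_def)

lemma annulus_subset_handle_set:
  assumes "i < kinks H"
  shows "annulus H i \<subseteq> handle_set H"
proof -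
  have "closed_segment (chart_a (kinks H) i 0) (chart_b (kinks H) i 0) \<subseteq> disk"
    using norm_chart_less_1[OF assms, of 0] by (intro closed_segment_subset) auto
  then show ?thesis
    unfolding annulus_def handle_set_def by (intro image_mono) auto
qed

lemma outer_boundary_Int_core_disk:
  assumes "kinky_handle H"
  shows "outer_boundary H \<inter> core_disk H = {}"
proof (rule ccontr)
  assume "outer_boundary H \<inter> core_disk H \<noteq> {}"
  then obtain x where x: "x \<in> outer_boundary H" "x \<in> core_disk H"
    by blast
  obtain z y where zy: "x = par H (z, y)" "cmod z < 1" "y \<in> disk" "wt H z * (cmod y)\<^sup>2 = 1/4"
    using x(1) unfolding outer_boundary_def by blast
  obtain w where w: "x = par H (w, 0)" "w \<in> disk"
    using x(2) unfolding core_disk_def core_map_def by blast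
  have "(z, y) \<in> disk \<times> disk" "(w, 0) \<in> disk \<times> disk" "par H (z, y) = par H (w, 0)"
    using zy w by auto
  with assms have "wt H z * (cmod y)\<^sup>2 = wt H w * (cmod 0)\<^sup>2"
  proof (rule kinky_handle_par_eqD)
    fix i assume "i < kinks H" "plumbed H i (z, y) (w, 0) \<or> plumbed H i (w, 0) (z, y)"
    then show ?thesis
      using plumbed_level_eq[OF assms, of i "(z, y)" "(w, 0)"]
        plumbed_level_eq[OF assms, of i "(w, 0)" "(z, y)"] by auto
  qed auto
  with zy(4) show False by simp
qed

lemma outer_boundary_Int_attaching_region:
  assumes "kinky_handle H"
  shows "outer_boundary H \<inter> attaching_region H = {}"
proof (rule ccontr)
  assume "outer_boundary H \<inter> attaching_region H \<noteq> {}"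
  then obtain x where x: "x \<in> outer_boundary H" "x \<in> attaching_region H"
    by blast
  obtain z y where zy: "x = par H (z, y)" "cmod z < 1" "y \<in> disk"
    using x(1) unfolding outer_boundary_def by blast
  obtain z' y' where zy': "x = par H (z', y')" "cmod z' = 1" "cmod y' \<le> 1/2"
    using x(2) unfolding attaching_region_def by blast
  have "(z, y) \<in> disk \<times> disk" "(z', y') \<in> disk \<times> disk" "par H (z, y) = par H (z', y')"
    using zy zy' by auto
  with assms have "cmod z' < 1"
  proof (rule kinky_handle_par_eqD)
    fix i assume "i < kinks H" "plumbed H i (z, y) (z', y') \<or> plumbed H i (z', y') (z, y)"
    then show ?thesis
      using plumbed_norm_base_less_1[of H i "(z, y)" "(z', y')"]
        plumbed_norm_base_less_1[of H i "(z', y')" "(z, y)"] by auto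
  qed (use zy(2) in simp)
  with zy'(2) show False by simp
qed

lemma continuous_on_core_map:
  assumes "kinky_handle H"
  shows "continuous_on disk (core_map H)"
proof -
  have "smooth_near disk (core_map H)"
    using assms by (simp add: kinky_handle_def kinky_disk_def self_transverse_immersion_def)
  then obtain U where U: "disk \<subseteq> U" "smooth_on U (core_map H)"
    unfolding smooth_near_def by blast
  from U(2) have "\<forall>x\<in>U. core_map H differentiable (at x)"
    by cases
  then have "isCont (core_map H) x" if "x \<in> disk" for x
    using U(1) that by (intro differentiable_imp_continuous_within) blast
  then show ?thesis
    by (intro continuous_at_imp_continuous_on) blast
qed

section \<open>The core and the outer boundary of a tower\<close>

lemma list_all2_in_set1:
  assumes "list_all2 P xs ys" "x \<in> set xs"
  shows "\<exists>y\<in>set ys. P x y"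
  using assms by induction auto

lemma list_all2_in_set2:
  assumes "list_all2 P xs ys" "y \<in> set ys"
  shows "\<exists>x\<in>set xs. P x y"
  using assms by induction auto

lemma casson_tower_top_stage:
  assumes "casson_tower n T"
  obtains T' L where "T = T' @ [L]"
    "\<And>H. H \<in> set L \<Longrightarrow> kinky_handle H"
    "\<And>H. H \<in> set L \<Longrightarrow> handle_set H \<inter> tower_set T' \<subseteq> attaching_region H"
    "\<And>H H'. H \<in> set L \<Longrightarrow> H' \<in> set L \<Longrightarrow> H \<noteq> H' \<Longrightarrow> handle_set H \<inter> handle_set H' = {}"
  using assms
proof cases
  case (one H)
  show ?thesis
    by (rule that[of "[]" "[H]"]) (use one in \<open>auto simp: tower_set_def\<close>)
next
  case (step m T' L)
  show ?thesis
  proof (rule that[of T' L])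
    show "kinky_handle H" if "H \<in> set L" for H
      using list_all2_in_set1[OF step(4) that] by auto
    show "handle_set H \<inter> handle_set H' = {}"
      if "H \<in> set L" "H' \<in> set L" "H \<noteq> H'" for H H'
      using step(6) that by (metis in_set_conv_nth)
  qed (use step in auto)
qed

text \<open>
  Only the core disks of the top stage have to be considered individually; everything else in the
  core, including the annuli, lies in the lower stages.
\<close>

lemma tower_core_append_subset:
  "tower_core (T @ [L]) \<subseteq> tower_set T \<union> (\<Union>H\<in>set L. core_disk H)"
proof -
  have "core_disk H \<subseteq> tower_set T" if "H \<in> set (concat T)" for H
    using core_disk_subset_handle_set[of H] that unfolding tower_set_def by blast
  moreover have "annulus H i \<subseteq> tower_set T" if "H \<in> set (concat T)" "i < kinks H" for H i
    using annulus_subset_handle_set[OF that(2)] that(1) unfolding tower_set_def by blast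
  ultimately have lower: "(\<Union>H\<in>set (concat T). core_disk H) \<subseteq> tower_set T"
      "(\<Union>H\<in>set (concat T). \<Union>i<kinks H. annulus H i) \<subseteq> tower_set T"
    by (intro UN_least; simp)+
  have "tower_core (T @ [L]) = (\<Union>H\<in>set (concat T). core_disk H) \<union> (\<Union>H\<in>set L. core_disk H) \<union>
      (\<Union>H\<in>set (concat T). \<Union>i<kinks H. annulus H i)"
    by (simp add: tower_core_def UN_Un)
  with lower show ?thesis
    by (simp add: le_supI1)
qed

lemma tower_core_subset_tower_set:
  assumes "T \<noteq> []"
  shows "tower_core T \<subseteq> tower_set T"
proof -
  obtain T' L where T: "T = T' @ [L]"
    using assms by (metis rev_exhaust)
  show ?thesis
    unfolding T
  proof (rule order_trans[OF tower_core_append_subset], intro Un_least UN_least)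
    show "core_disk H \<subseteq> tower_set (T' @ [L])" if "H \<in> set L" for H
      using core_disk_subset_handle_set[of H] that by (auto simp: tower_set_def)
  qed (auto simp: tower_set_def)
qed

lemma outer_boundary_Int_tower_core:
  assumes "casson_tower n T" "H \<in> set (last T)"
  shows "outer_boundary H \<inter> tower_core T = {}"
  using assms(1)
proof (rule casson_tower_top_stage)
  fix T' L
  assume T: "T = T' @ [L]"
    and kinky: "\<And>H. H \<in> set L \<Longrightarrow> kinky_handle H"
    and below: "\<And>H. H \<in> set L \<Longrightarrow> handle_set H \<inter> tower_set T' \<subseteq> attaching_region H"
    and disj: "\<And>H H'. H \<in> set L \<Longrightarrow> H' \<in> set L \<Longrightarrow> H \<noteq> H' \<Longrightarrow> handle_set H \<inter> handle_set H' = {}"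
  have H: "H \<in> set L" using assms(2) T by simp
  have "outer_boundary H \<inter> tower_set T' = {}"
    using below[OF H] outer_boundary_Int_attaching_region[OF kinky[OF H]]
      outer_boundary_subset_handle_set[of H] by blast
  moreover have "outer_boundary H \<inter> core_disk H' = {}" if "H' \<in> set L" for H'
  proof (cases "H' = H")
    case True
    then show ?thesis using outer_boundary_Int_core_disk kinky H by blast
  next
    case False
    then show ?thesis
      using disj[OF H that] outer_boundary_subset_handle_set[of H]
        core_disk_subset_handle_set[of H'] by blast
  qed
  ultimately show ?thesis
    using tower_core_append_subset[of T' L] unfolding T by blast
qed

section \<open>Null-homotopic loops and the derived series\<close>

text \<open>
  Each term of the derived series after the first is by definition a generated set, and the unit
  element is among the generating rules of such a set.
\<close>

lemma one_in_derived_power: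
  assumes "\<one>\<^bsub>G\<^esub> \<in> carrier G"
  shows "\<one>\<^bsub>G\<^esub> \<in> (derived G ^^ n) (carrier G)"
  using assms by (cases n) (auto simp: derived_def intro: generate.one)

lemma in_derived_pi1_if_null_homotopic:
  assumes "homotopic_paths X c (linepath (pathstart c) (pathstart c))"
  shows "in_derived_pi1 n X c"
proof -
  let ?G = "fundamental_group X (pathstart c)"
  have c: "path c" "path_image c \<subseteq> X" "pathfinish c = pathstart c"
    using homotopic_paths_imp_path[OF assms] homotopic_paths_imp_subset[OF assms]
      homotopic_paths_imp_pathfinish[OF assms] by auto
  have eq: "path_class X c = \<one>\<^bsub>?G\<^esub>"
    using assms unfolding path_class_def fundamental_group_def
    by (auto intro: homotopic_paths_trans homotopic_paths_sym)
  have "path_class X c \<in> carrier ?G"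
    using c by (auto simp: fundamental_group_def)
  then show ?thesis
    using c one_in_derived_power[of ?G n] unfolding in_derived_pi1_def eq by simp
qed

text \<open>
  The boundary circle contracts linearly in the disk; composing with \<open>f\<close> contracts \<open>c\<close>.
  Kinks do no harm, because this works for every continuous \<open>f\<close>.  The reparametrization \<open>h\<close> enters because
  towers match standard and attaching curves only up to a reparametrization.
\<close>

lemma null_homotopic_if_extends_to_disk:
  fixes f :: "complex \<Rightarrow> 'a::real_normed_vector"
  assumes f: "continuous_on disk f" "f ` disk \<subseteq> X"
    and h: "continuous_on {0..1} h" "h 0 = 0" "h 1 = 1"
    and c: "\<And>u. u \<in> {0..1} \<Longrightarrow> c u = f (cis (2 * pi * h u))"
  shows "homotopic_paths X c (linepath (pathstart c) (pathstart c))"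
proof -
  let ?p = "\<lambda>u. cis (2 * pi * h u)"
  have p: "path ?p"
    unfolding path_def using h(1) by (intro continuous_intros)
  have "homotopic_paths disk ?p (linepath 1 1)"
  proof (rule homotopic_paths_linear)
    show "closed_segment (?p t) (linepath 1 1 t) \<subseteq> disk" if "t \<in> {0..1}" for t
      by (intro closed_segment_subset) (auto simp: linepath_refl)
  qed (use p h in \<open>auto simp: pathstart_def pathfinish_def linepath_refl path_def\<close>)
  then have fp: "homotopic_paths X (f \<circ> ?p) (f \<circ> linepath 1 1)"
    by (rule homotopic_paths_continuous_image) (use f in auto)
  have "homotopic_paths X (f \<circ> ?p) c"
    by (rule homotopic_paths_eq)
       (use homotopic_paths_imp_path[OF fp] homotopic_paths_imp_subset[OF fp] c in auto)
  moreover have "f \<circ> linepath 1 1 = linepath (pathstart c) (pathstart c)"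
    using c[of 0] h(2) by (auto simp: fun_eq_iff linepath_refl pathstart_def)
  ultimately show ?thesis
    using fp by (metis homotopic_paths_sym homotopic_paths_trans)
qed

section \<open>Standard curves bound disks in the next stage\<close>

text \<open>
  The attaching condition expresses the attaching curve through the standard curve; for the
  homotopy the standard curve itself has to be expressed through the core map.
\<close>

lemma attached_std_curve:
  assumes "attached H' H i"
  obtains h where "continuous_on {0..1} h" "h 0 = 0" "h 1 = 1"
    "\<And>u. u \<in> {0..1} \<Longrightarrow> std_curve H i u = core_map H' (cis (2 * pi * h u))"
proof -
  obtain g where g: "continuous_on {0..1} g" "strict_mono_on {0..1} g" "g 0 = 0" "g 1 = 1"
    and eq: "\<And>t. t \<in> {0..1} \<Longrightarrow> core_map H' (cis (2 * pi * t)) = std_curve H i (g t)"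
    using assms unfolding attached_def by blast
  have inj: "inj_on g {0..1}"
    using g(2) by (rule strict_mono_on_imp_inj_on)
  have im: "g ` {0..1} = {0..1}"
  proof (rule antisym)
    show "g ` {0..1} \<subseteq> {0..1}"
      using g(3,4) strict_mono_on_leD[OF g(2), of 0] strict_mono_on_leD[OF g(2), of _ 1] by auto
    show "{0..1} \<subseteq> g ` {0..1}"
    proof
      fix y :: real assume "y \<in> {0..1}"
      then show "y \<in> g ` {0..1}"
        using IVT'[of g 0 y 1] g by fastforce
    qed
  qed
  let ?h = "the_inv_into {0..1} g"
  have h: "?h (g t) = t" if "t \<in> {0..1}" for t
    using the_inv_into_f_f[OF inj that] .
  show ?thesis
  proof (rule that[of ?h])
    show "continuous_on {0..1} ?h"
      using continuous_on_inv[OF g(1) compact_Icc, of ?h] h im by simp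
    show "?h 0 = 0" "?h 1 = 1"
      using h[of 0] h[of 1] g(3,4) by simp_all
    show "std_curve H i u = core_map H' (cis (2 * pi * ?h u))" if "u \<in> {0..1}" for u
    proof -
      have "u \<in> g ` {0..1}"
        unfolding im using that .
      then obtain t where "t \<in> {0..1}" "u = g t"
        by (elim imageE)
      then show ?thesis by (simp add: h eq)
    qed
  qed
qed

text \<open>
  The core disk of the handle attached along a standard curve is the null-homotopy.  It meets the
  tower only in the outer boundary of a top-stage handle, hence misses the core.
\<close>

lemma curves_in_derived_if_next_stage:
  assumes T: "casson_tower m T"
    and L: "list_all2 (\<lambda>H' (H, i). kinky_handle H' \<and> attached H' H i) L (standard_set T)"
    and meet: "\<forall>H'\<in>set L. handle_set H' \<inter> tower_set T = attaching_region H'"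
    and B4: "tower_set (T @ [L]) \<subseteq> B4"
  shows "curves_in_derived n T"
  unfolding curves_in_derived_def
proof clarify
  fix H i assume Hi: "(H, i) \<in> set (standard_set T)"
  then obtain H' where H': "H' \<in> set L" "kinky_handle H'" "attached H' H i"
    using list_all2_in_set2[OF L] by auto
  have H: "H \<in> set (last T)"
    using Hi by (auto simp: standard_set_def)
  have "T \<noteq> []"
    using T by cases auto
  have "core_disk H' \<inter> tower_core T \<subseteq> handle_set H' \<inter> tower_set T"
    using core_disk_subset_handle_set tower_core_subset_tower_set[OF \<open>T \<noteq> []\<close>] by blast
  also have "\<dots> \<subseteq> outer_boundary H"
    using meet H' by (auto simp: attached_def)
  finally have "core_disk H' \<inter> tower_core T = {}"
    using outer_boundary_Int_tower_core[OF T H] by blast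
  moreover have "core_disk H' \<subseteq> B4"
    using core_disk_subset_handle_set[of H'] B4 H'(1) by (fastforce simp: tower_set_def)
  ultimately have disk: "core_map H' ` disk \<subseteq> B4 - tower_core T"
    unfolding core_disk_def by blast
  obtain h where "continuous_on {0..1} h" "h 0 = 0" "h 1 = 1"
    "\<And>u. u \<in> {0..1} \<Longrightarrow> std_curve H i u = core_map H' (cis (2 * pi * h u))"
    using attached_std_curve[OF H'(3)] by blast
  then show "in_derived_pi1 n (B4 - tower_core T) (std_curve H i)"
    using continuous_on_core_map[OF H'(2)] disk
    by (intro in_derived_pi1_if_null_homotopic null_homotopic_if_extends_to_disk)
qed

section \<open>Forgetting the third stage\<close>

lemma first_handle_casson_tower:
  assumes "casson_tower n T"
  shows "T \<noteq> [] \<and> hd T \<noteq> [] \<and> kinky_handle (first_handle T)"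
  using assms by induction auto

text \<open>
  The attaching region already lies in the first stage, so removing the top stage does not change
  the intersection with \<open>S\<^sup>3\<close>.
\<close>

lemma bounds_tower_truncate:
  assumes "casson_tower n T" "bounds_tower K (T @ [L])"
  shows "bounds_tower K T"
proof -
  have ne: "T \<noteq> []" "hd T \<noteq> []" and kinky: "kinky_handle (first_handle T)"
    using first_handle_casson_tower[OF assms(1)] by auto
  have first: "first_handle (T @ [L]) = first_handle T"
    using ne by simp
  have sub: "tower_set T \<subseteq> tower_set (T @ [L])"
    by (auto simp: tower_set_def)
  have "first_handle T \<in> set (concat T)"
    using ne by (metis UN_I hd_in_set set_concat)
  then have "attaching_region (first_handle T) \<subseteq> tower_set T"
    using attaching_region_subset_handle_set[OF kinky] unfolding tower_set_def by blast
  then show ?thesis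
    using assms(2) sub unfolding bounds_tower_def first by blast
qed

lemma casson_tower_3_truncate:
  assumes "casson_tower 3 T" "bounds_tower K T"
  obtains T' where "casson_tower 2 T'" "bounds_tower K T'" "curves_in_derived n T'"
    "first_handle T' = first_handle T"
  using assms(1)
proof cases
  case (step m T' L)
  then have T': "casson_tower 2 T'" by (simp add: numeral_eq_Suc)
  show ?thesis
  proof (rule that[OF T'])
    show "bounds_tower K T'"
      using bounds_tower_truncate[OF T'] assms(2) step(2) by simp
    have "tower_set (T' @ [L]) \<subseteq> B4"
      using assms(2) step(2) unfolding bounds_tower_def by simp
    then show "curves_in_derived n T'"
      using curves_in_derived_if_next_stage[OF T'] step by blast
    show "first_handle T' = first_handle T"
      using first_handle_casson_tower[OF T'] step(2) by simp
  qed
qed auto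

theorem corollary3p4:
  fixes n :: nat
  shows "C3 \<subseteq> C2 n \<and> C3_pos \<subseteq> C2_pos n \<and> C3_neg \<subseteq> C2_neg n"
proof -
  have "\<exists>T'. casson_tower 2 T' \<and> bounds_tower K T' \<and> curves_in_derived n T' \<and>
      first_handle T' = first_handle T"
    if "casson_tower 3 T" "bounds_tower K T" for K T
    using casson_tower_3_truncate[OF that] by metis
  then show ?thesis
    unfolding C3_def C3_pos_def C3_neg_def C2_def C2_pos_def C2_neg_def
      base_positive_def base_negative_def by (auto; metis)
qed

end
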